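(* There exists a kernelization algorithm for \textsc{DPVC}, parameterized by the number $k$ of vertices that receive a positive value, that produces a kernel with $O(k^2)$ vertices. That is, there is a polynomial-time algorithm that maps each instance of the decision problem below to an equivalent instance of the same decision problem whose parameter is at most $k$ and whose graph has $O(k^2)$ vertices.
   Context: \textsc{Directed Power Vertex Cover (DPVC)}: the input is a finite simple undirected graph $G=(V,E)$ together with, for each edge $(u,v)\in E$, two positive integers $w_{u,v}$ and $w_{v,u}$. A feasible solution assigns to each $v\in V$ a value $p_v\ge 0$ such that for every edge $(u,v)\in E$ we have $p_u\ge w_{u,v}$ or $p_v\ge w_{v,u}$. Its total power is $\sum_{v\in V}p_v$, to be minimized. Decision problem parameterized by $k$: given a \textsc{DPVC} instance, an integer $k$ (the parameter) and an integer $P$, is there a feasible solution of total power at most $P$ in which at most $k$ vertices receive a positive value? Two instances are equivalent if they have the same answer. The kernel size bound concerns the number of vertices only (not the encoding length of the weights). *)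

theory Defs
  imports
    Complex_Main
    "HOL-Library.Landau_Symbols"
    "HOL-Library.Product_Lexorder"
    "HOL-Computational_Algebra.Polynomial"
    "Graph_Theory.Pair_Digraph"
begin

text \<open>
  Algorithms are programs of Jones' language WHILE, an imperative language whose data are binary
  trees (N. D. Jones, Computability and Complexity from a Programming Perspective, 1997).  A step is
  not charged at unit cost: every evaluation of an expression is charged for the sizes of the values
  of all its subexpressions.  A run of cost n therefore never builds data larger than its input
  plus n, sharing of subtrees cannot hide exponentially large data, and the class of functions
  computed at polynomial cost is that of polynomial-time multitape Turing machines.
\<close>

datatype bt = Leaf | Fork bt bt

text \<open>The function \<^term>\<open>size :: bt \<Rightarrow> nat\<close> counts the occurrences of \<^const>\<open>Fork\<close>.\<close>

datatype expr =
    Var nat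
  | LeafE
  | ForkE expr expr
  | Left expr
  | Right expr
  | EqE expr expr

datatype com =
    Skip
  | Assign nat expr
  | Seq com com
  | Cond expr com com
  | While expr com

type_synonym store = "nat \<Rightarrow> bt"

fun left :: "bt \<Rightarrow> bt" where
  "left Leaf = Leaf"
| "left (Fork a b) = a"

fun right :: "bt \<Rightarrow> bt" where
  "right Leaf = Leaf"
| "right (Fork a b) = b"

definition enc_bool :: "bool \<Rightarrow> bt" where
  "enc_bool b = (if b then Fork Leaf Leaf else Leaf)"

fun val :: "expr \<Rightarrow> store \<Rightarrow> bt" where
  "val (Var x) s = s x"
| "val LeafE s = Leaf"
| "val (ForkE e f) s = Fork (val e s) (val f s)"
| "val (Left e) s = left (val e s)"
| "val (Right e) s = right (val e s)"
| "val (EqE e f) s = enc_bool (val e s = val f s)"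

fun cost :: "expr \<Rightarrow> store \<Rightarrow> nat" where
  "cost (Var x) s = 1 + size (s x)"
| "cost LeafE s = 1"
| "cost (ForkE e f) s = 1 + size (val (ForkE e f) s) + cost e s + cost f s"
| "cost (Left e) s = 1 + size (val (Left e) s) + cost e s"
| "cost (Right e) s = 1 + size (val (Right e) s) + cost e s"
| "cost (EqE e f) s = 1 + size (val (EqE e f) s) + cost e s + cost f s"

text \<open>
  \<open>exec c s n t\<close>: started in store \<open>s\<close>, the program \<open>c\<close> halts in store \<open>t\<close> at total cost \<open>n\<close>.
  In tests, every tree other than \<^const>\<open>Leaf\<close> counts as true.
\<close>

inductive exec :: "com \<Rightarrow> store \<Rightarrow> nat \<Rightarrow> store \<Rightarrow> bool" where
  Skip: "exec Skip s 1 s"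
| Assign: "exec (Assign x e) s (1 + cost e s) (s(x := val e s))"
| Seq: "exec c s m s' \<Longrightarrow> exec d s' n t \<Longrightarrow> exec (Seq c d) s (1 + m + n) t"
| CondTrue: "val e s \<noteq> Leaf \<Longrightarrow> exec c s n t \<Longrightarrow> exec (Cond e c d) s (1 + cost e s + n) t"
| CondFalse: "val e s = Leaf \<Longrightarrow> exec d s n t \<Longrightarrow> exec (Cond e c d) s (1 + cost e s + n) t"
| WhileFalse: "val e s = Leaf \<Longrightarrow> exec (While e c) s (1 + cost e s) s"
| WhileTrue: "val e s \<noteq> Leaf \<Longrightarrow> exec c s m s' \<Longrightarrow> exec (While e c) s' n t
    \<Longrightarrow> exec (While e c) s (1 + cost e s + m + n) t"

text \<open>
  The input is passed in variable 0, where the output is also left; all other variables start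
  with \<^const>\<open>Leaf\<close>.  Nothing is required of runs on trees that encode no element of \<open>A\<close>.
\<close>

definition poly_time_on :: "('i \<Rightarrow> bt) \<Rightarrow> 'i set \<Rightarrow> ('i \<Rightarrow> 'i) \<Rightarrow> bool" where
  "poly_time_on enc A f \<longleftrightarrow>
    (\<exists>(c :: com) (q :: nat poly). \<forall>x\<in>A. \<exists>n t.
      exec c ((\<lambda>_. Leaf)(0 := enc x)) n t \<and> t 0 = enc (f x) \<and> n \<le> poly q (size (enc x)))"

text \<open>
  A kernelization of a parameterized problem, given by an encoding of its instances, the set of its
  instances, the set-theoretic answer \<open>yes\<close> and the parameter \<open>\<kappa>\<close>, here with the requirement that
  the parameter does not increase.  The bound on the size of the kernel is stated separately.
\<close>

definition kernelization ::
  "('i \<Rightarrow> bt) \<Rightarrow> 'i set \<Rightarrow> ('i \<Rightarrow> bool) \<Rightarrow> ('i \<Rightarrow> nat) \<Rightarrow> ('i \<Rightarrow> 'i) \<Rightarrow> bool" where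
  "kernelization enc A yes \<kappa> K \<longleftrightarrow>
    poly_time_on enc A K \<and>
    (\<forall>I\<in>A. K I \<in> A \<and> (yes (K I) \<longleftrightarrow> yes I) \<and> \<kappa> (K I) \<le> \<kappa> I)"

text \<open>
  Vertices are named by natural numbers.  An undirected edge is represented by its two
  orientations, and \<open>weight I u v\<close> is the power that \<open>u\<close> needs to cover the edge between \<open>u\<close> and
  \<open>v\<close>; the values of \<open>weight I\<close> at non-adjacent pairs are irrelevant.
\<close>

record dpvc =
  ugraph :: "nat pair_pre_digraph"
  weight :: "nat \<Rightarrow> nat \<Rightarrow> nat"
  param :: nat
  budget :: int

text \<open>The locale predicate \<^const>\<open>pair_graph\<close> holds of the finite, loop-free, symmetric digraphs.\<close>

definition dpvc_instances :: "dpvc set" where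
  "dpvc_instances =
    {I. pair_graph (ugraph I) \<and> (\<forall>(u, v) \<in> parcs (ugraph I). 0 < weight I u v)}"

definition feasible :: "dpvc \<Rightarrow> (nat \<Rightarrow> real) \<Rightarrow> bool" where
  "feasible I p \<longleftrightarrow>
    (\<forall>v \<in> pverts (ugraph I). 0 \<le> p v) \<and>
    (\<forall>(u, v) \<in> parcs (ugraph I). real (weight I u v) \<le> p u \<or> real (weight I v u) \<le> p v)"

definition dpvc_yes :: "dpvc \<Rightarrow> bool" where
  "dpvc_yes I \<longleftrightarrow>
    (\<exists>p. feasible I p \<and> (\<Sum>v \<in> pverts (ugraph I). p v) \<le> real_of_int (budget I) \<and>
      card {v \<in> pverts (ugraph I). 0 < p v} \<le> param I)"

text \<open>
  Numbers are encoded in binary, least significant bit first, so that the size of an encoded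
  instance is its bit length up to a constant factor.  Every edge is listed once, from its smaller
  to its larger endpoint, together with both of its weights.
\<close>

fun enc_nat :: "nat \<Rightarrow> bt" where
  "enc_nat n = (if n = 0 then Leaf else Fork (enc_bool (odd n)) (enc_nat (n div 2)))"

declare enc_nat.simps [simp del]

definition enc_int :: "int \<Rightarrow> bt" where
  "enc_int i = Fork (enc_bool (i < 0)) (enc_nat (nat \<bar>i\<bar>))"

fun enc_list :: "('a \<Rightarrow> bt) \<Rightarrow> 'a list \<Rightarrow> bt" where
  "enc_list enc [] = Leaf"
| "enc_list enc (x # xs) = Fork (enc x) (enc_list enc xs)"

definition enc_edge :: "(nat \<Rightarrow> nat \<Rightarrow> nat) \<Rightarrow> nat \<times> nat \<Rightarrow> bt" where
  "enc_edge w = (\<lambda>(u, v).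
    Fork (Fork (enc_nat u) (enc_nat v)) (Fork (enc_nat (w u v)) (enc_nat (w v u))))"

definition enc_dpvc :: "dpvc \<Rightarrow> bt" where
  "enc_dpvc I =
    Fork
      (Fork (enc_list enc_nat (sorted_list_of_set (pverts (ugraph I))))
            (enc_list (enc_edge (weight I))
              (sorted_list_of_set {(u, v) \<in> parcs (ugraph I). u < v})))
      (Fork (enc_nat (param I)) (enc_int (budget I)))"

lemma size_val_le_cost: "size (val e s) \<le> cost e s"
  by (cases e) auto

lemma exec_size_le: "exec c s n t \<Longrightarrow> size (t x) \<le> size (s x) + n"
proof (induction rule: exec.induct)
  case (Assign y e s)
  then show ?case using size_val_le_cost[of e s] by auto
qed auto

lemma exec_deterministic: "exec c s n t \<Longrightarrow> exec c s n' t' \<Longrightarrow> n' = n \<and> t' = t"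
proof (induction arbitrary: n' t' rule: exec.induct)
  case (Seq c s m s' d n t)
  from Seq.prems show ?case
    by cases (use Seq.IH in blast)
next
  case (WhileTrue e s c m s' n t)
  from WhileTrue.prems show ?case
    by cases (use WhileTrue in blast)+
qed (erule exec.cases; fastforce)+

end

theory Submission
  imports Defs
begin

text \<open>
  Let \<open>e\<close> be an edge at \<open>x\<close> such that at least \<open>k + 1\<close> other edges at \<open>x\<close> need at least as much power
  at \<open>x\<close> as \<open>e\<close> does.  If \<open>x\<close> has too little power to cover \<open>e\<close>, then these edges are covered by
  their other endpoints, so that more than \<open>k\<close> vertices are positive.  Hence \<open>e\<close> may be deleted.
  Deleting such edges one after the other leaves a graph of maximum degree at most \<open>k + 1\<close>; a
  solution covers at most \<open>k (k + 1)\<close> of its edges.  If more are left, the answer is no; otherwise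
  deleting the isolated vertices leaves at most \<open>2 k (k + 1)\<close> vertices.  Polynomial time follows
  from closure under composition, conditionals and folds over lists in which every element adds at
  most its own size plus a constant to the accumulator.
\<close>

section \<open>Closure properties of polynomial time\<close>

text \<open>Natural coefficients make evaluation monotone, so a size bound on an intermediate value
  can be inserted into the cost polynomial of the next program.\<close>

lemma poly_nat_mono:
  fixes q :: "nat poly"
  assumes "m \<le> n"
  shows "poly q m \<le> poly q n"
  using assms by (induction q) (auto intro!: add_mono mult_mono)

definition runs :: "com \<Rightarrow> nat \<Rightarrow> nat \<Rightarrow> nat \<Rightarrow> (bt \<Rightarrow> bt) \<Rightarrow> nat poly \<Rightarrow> bool" where
  "runs c x y b f q \<longleftrightarrow>
    (\<forall>s. \<exists>n t. exec c s n t \<and> t y = f (s x) \<and> (\<forall>z<b. z \<noteq> y \<longrightarrow> t z = s z) \<and>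
      n \<le> poly q (size (s x)))"

text \<open>
  Demanding a program for every choice of registers, which may use those from \<open>b\<close> on as scratch
  space with arbitrary initial contents, makes programs composable without renaming variables.
\<close>

definition ptime :: "(bt \<Rightarrow> bt) \<Rightarrow> bool" where
  "ptime f \<longleftrightarrow> (\<exists>q. \<forall>x y b. x < b \<longrightarrow> y < b \<longrightarrow> (\<exists>c. runs c x y b f q))"

lemma runsE:
  assumes "runs c x y b f q"
  obtains n t where "exec c s n t" "t y = f (s x)" "\<And>z. z < b \<Longrightarrow> z \<noteq> y \<Longrightarrow> t z = s z"
    "n \<le> poly q (size (s x))"
  using assms unfolding runs_def by blast

lemma ptime_poly_time_on:
  assumes "ptime F" "\<And>x. x \<in> A \<Longrightarrow> F (enc x) = enc (f x)"
  shows "poly_time_on enc A f"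
proof -
  obtain q c where "runs c 0 0 1 F q"
    using assms(1) unfolding ptime_def by (meson zero_less_one)
  then show ?thesis
    unfolding poly_time_on_def runs_def using assms(2) by (metis fun_upd_same)
qed

text \<open>A run of cost \<open>n\<close> enlarges no register by more than \<open>n\<close>, and
  the output register can be started with \<open>Leaf\<close>; so the time bound also bounds the
  output.\<close>

lemma ptime_size:
  assumes "ptime f"
  shows "\<exists>q. \<forall>v. size (f v) \<le> poly q (size v)"
proof -
  obtain q c where c: "runs c 0 1 2 f q"
    using assms unfolding ptime_def by (metis one_less_numeral_iff semiring_norm(76) zero_less_numeral)
  have "size (f v) \<le> poly q (size v)" for v
  proof -
    obtain n t where "exec c ((\<lambda>_. Leaf)(0 := v)) n t" "t 1 = f v" "n \<le> poly q (size v)"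
      using runsE[OF c, of "(\<lambda>_. Leaf)(0 := v)"] by (metis fun_upd_same)
    then show ?thesis
      using exec_size_le[of c "(\<lambda>_. Leaf)(0 := v)" n t 1] by simp
  qed
  then show ?thesis by blast
qed

lemma ptime_expr:
  assumes "\<And>v s. val (e v) s = h (s v)" "\<And>v s. cost (e v) s \<le> poly q (size (s v))"
  shows "ptime h"
proof -
  have "runs (Assign y (e x)) x y b h ([:1:] + q)" for x y b
    unfolding runs_def
  proof (intro allI exI conjI)
    show "exec (Assign y (e x)) s (1 + cost (e x) s) (s(y := val (e x) s))" for s
      by (rule exec.Assign)
  qed (use assms in auto)
  then show ?thesis unfolding ptime_def by blast
qed

lemma ptime_id: "ptime (\<lambda>x. x)"
  by (rule ptime_expr[of Var _ "[:1, 1:]"]) auto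

lemma ptime_Leaf: "ptime (\<lambda>x. Leaf)"
  by (rule ptime_expr[of "\<lambda>_. LeafE" _ "[:1:]"]) auto

lemma size_left: "size (left x) \<le> size x"
  by (cases x) auto

lemma size_right: "size (right x) \<le> size x"
  by (cases x) auto

lemma size_enc_bool: "size (enc_bool b) \<le> 1"
  by (simp add: enc_bool_def)

text \<open>The intermediate result goes to the scratch register \<open>b\<close>. Its size is
  polynomial by \<open>ptime_size\<close>, so substituting that bound into the polynomial of
  \<open>f\<close> gives a polynomial again.\<close>

lemma ptime_comp:
  assumes "ptime f" "ptime g"
  shows "ptime (\<lambda>x. f (g x))"
proof -
  obtain qf where qf: "\<And>x y b. x < b \<Longrightarrow> y < b \<Longrightarrow> \<exists>c. runs c x y b f qf"
    using assms(1) unfolding ptime_def by blast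
  obtain qg where qg: "\<And>x y b. x < b \<Longrightarrow> y < b \<Longrightarrow> \<exists>c. runs c x y b g qg"
    using assms(2) unfolding ptime_def by blast
  obtain r where r: "\<And>v. size (g v) \<le> poly r (size v)"
    using ptime_size[OF assms(2)] by blast
  have "\<exists>c. runs c x y b (\<lambda>x. f (g x)) ([:1:] + qg + pcompose qf r)" if xy: "x < b" "y < b" for x y b
  proof -
    obtain c where c: "runs c x b (Suc b) g qg"
      using qg[of x "Suc b" b] xy by auto
    obtain d where d: "runs d b y (Suc b) f qf"
      using qf[of b "Suc b" y] xy by auto
    have "\<exists>n t. exec (Seq c d) s n t \<and> t y = f (g (s x)) \<and> (\<forall>z<b. z \<noteq> y \<longrightarrow> t z = s z) \<and>
        n \<le> poly ([:1:] + qg + pcompose qf r) (size (s x))" for s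
    proof -
      obtain m s' where 1: "exec c s m s'" "s' b = g (s x)"
        "\<And>z. z < Suc b \<Longrightarrow> z \<noteq> b \<Longrightarrow> s' z = s z" "m \<le> poly qg (size (s x))"
        using runsE[OF c, of s] by metis
      obtain n t where 2: "exec d s' n t" "t y = f (s' b)"
        "\<And>z. z < Suc b \<Longrightarrow> z \<noteq> y \<Longrightarrow> t z = s' z" "n \<le> poly qf (size (s' b))"
        using runsE[OF d, of s'] by metis
      have "poly qf (size (g (s x))) \<le> poly qf (poly r (size (s x)))"
        using poly_nat_mono r by blast
      then have "1 + m + n \<le> poly ([:1:] + qg + pcompose qf r) (size (s x))"
        using 1 2 by (simp add: poly_pcompose)
      moreover have "exec (Seq c d) s (1 + m + n) t"
        using 1 2 by (blast intro: exec.Seq)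
      ultimately show ?thesis using 1(2,3) 2(2,3) by (metis less_Suc_eq less_irrefl)
    qed
    then show ?thesis unfolding runs_def by blast
  qed
  then show ?thesis unfolding ptime_def by blast
qed

lemma ptime_left: "ptime f \<Longrightarrow> ptime (\<lambda>x. left (f x))"
  by (rule ptime_comp[of left], rule ptime_expr[of "\<lambda>v. Left (Var v)" _ "[:2, 2:]"])
    (auto intro: le_trans[OF size_left])

lemma ptime_right: "ptime f \<Longrightarrow> ptime (\<lambda>x. right (f x))"
  by (rule ptime_comp[of right], rule ptime_expr[of "\<lambda>v. Right (Var v)" _ "[:2, 2:]"])
    (auto intro: le_trans[OF size_right])

lemma ptime_Fork:
  assumes "ptime f" "ptime g"
  shows "ptime (\<lambda>x. Fork (f x) (g x))"
proof -
  obtain qf where qf: "\<And>x y b. x < b \<Longrightarrow> y < b \<Longrightarrow> \<exists>c. runs c x y b f qf"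
    using assms(1) unfolding ptime_def by blast
  obtain qg where qg: "\<And>x y b. x < b \<Longrightarrow> y < b \<Longrightarrow> \<exists>c. runs c x y b g qg"
    using assms(2) unfolding ptime_def by blast
  obtain rf where rf: "\<And>v. size (f v) \<le> poly rf (size v)"
    using ptime_size[OF assms(1)] by blast
  obtain rg where rg: "\<And>v. size (g v) \<le> poly rg (size v)"
    using ptime_size[OF assms(2)] by blast
  \<comment> \<open>Two \<open>Seq\<close> and one \<open>Assign\<close> cost 3; the final
    expression costs 4 plus twice the sizes of both results.\<close>
  define q where "q = [:7:] + qf + qg + rf + rf + rg + rg"
  have "\<exists>c. runs c x y b (\<lambda>x. Fork (f x) (g x)) q" if xy: "x < b" "y < b" for x y b
  proof -
    obtain c where c: "runs c x b (Suc b) f qf"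
      using qf[of x "Suc b" b] xy by auto
    \<comment> \<open>The raised bound protects the first result, which waits in register
      \<open>b\<close>.\<close>
    obtain d where d: "runs d x (Suc b) (Suc (Suc b)) g qg"
      using qg[of x "Suc (Suc b)" "Suc b"] xy by auto
    let ?e = "ForkE (Var b) (Var (Suc b))"
    have "\<exists>n t. exec (Seq c (Seq d (Assign y ?e))) s n t \<and> t y = Fork (f (s x)) (g (s x)) \<and>
        (\<forall>z<b. z \<noteq> y \<longrightarrow> t z = s z) \<and> n \<le> poly q (size (s x))" for s
    proof -
      obtain m s1 where 1: "exec c s m s1" "s1 b = f (s x)"
        "\<And>z. z < Suc b \<Longrightarrow> z \<noteq> b \<Longrightarrow> s1 z = s z" "m \<le> poly qf (size (s x))"
        using runsE[OF c, of s] by metis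
      obtain n s2 where 2: "exec d s1 n s2" "s2 (Suc b) = g (s1 x)"
        "\<And>z. z < Suc (Suc b) \<Longrightarrow> z \<noteq> Suc b \<Longrightarrow> s2 z = s1 z" "n \<le> poly qg (size (s1 x))"
        using runsE[OF d, of s1] by metis
      have v: "s1 x = s x" "s2 b = f (s x)" "s2 (Suc b) = g (s x)"
        using 1 2 xy by auto
      let ?t = "s2(y := val ?e s2)"
      have ex: "exec (Seq c (Seq d (Assign y ?e))) s (1 + m + (1 + n + (1 + cost ?e s2))) ?t"
        using 1 2 by (blast intro: exec.Seq exec.Assign)
      have bnd: "1 + m + (1 + n + (1 + cost ?e s2)) \<le> poly q (size (s x))"
        using 1(4) 2(4) rf[of "s x"] rg[of "s x"] v by (simp add: q_def)
      have "?t z = s z" if "z < b" "z \<noteq> y" for z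
        using 1(3) 2(3) that by simp
      then show ?thesis using ex bnd v by (intro exI[of _ ?t] exI) (auto intro: ex bnd)
    qed
    then show ?thesis unfolding runs_def by blast
  qed
  then show ?thesis unfolding ptime_def by blast
qed

text \<open>Polynomial time is defined for unary functions; a binary one is treated as a function of
  the pair of its arguments.\<close>

lemma ptime_app2:
  assumes "ptime (\<lambda>y. h (left y) (right y))" "ptime f" "ptime g"
  shows "ptime (\<lambda>x. h (f x) (g x))"
  using ptime_comp[OF assms(1) ptime_Fork[OF assms(2,3)]] by simp

lemma ptime_eq:
  assumes "ptime f" "ptime g"
  shows "ptime (\<lambda>x. enc_bool (f x = g x))"
proof (rule ptime_app2[of "\<lambda>a b. enc_bool (a = b)", OF _ assms])
  show "ptime (\<lambda>y. enc_bool (left y = right y))"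
  proof (rule ptime_expr)
    fix v s
    show "cost (EqE (Left (Var v)) (Right (Var v))) s \<le> poly [:6, 4:] (size (s v))"
      using size_left[of "s v"] size_right[of "s v"] size_enc_bool[of "left (s v) = right (s v)"]
      by simp
  qed simp
qed

lemma ptime_if:
  assumes "ptime f" "ptime g" "ptime h"
  shows "ptime (\<lambda>x. if f x \<noteq> Leaf then g x else h x)"
proof -
  obtain qf where qf: "\<And>x y b. x < b \<Longrightarrow> y < b \<Longrightarrow> \<exists>c. runs c x y b f qf"
    using assms(1) unfolding ptime_def by blast
  obtain qg where qg: "\<And>x y b. x < b \<Longrightarrow> y < b \<Longrightarrow> \<exists>c. runs c x y b g qg"
    using assms(2) unfolding ptime_def by blast
  obtain qh where qh: "\<And>x y b. x < b \<Longrightarrow> y < b \<Longrightarrow> \<exists>c. runs c x y b h qh"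
    using assms(3) unfolding ptime_def by blast
  obtain rf where rf: "\<And>v. size (f v) \<le> poly rf (size v)"
    using ptime_size[OF assms(1)] by blast
  \<comment> \<open>The sum of the bounds of both branches dominates whichever branch is
    taken.\<close>
  define q where "q = [:7:] + qf + qg + qh + rf"
  have "\<exists>c. runs c x y b (\<lambda>x. if f x \<noteq> Leaf then g x else h x) q" if xy: "x < b" "y < b" for x y b
  proof -
    obtain c where c: "runs c x b (Suc b) f qf"
      using qf[of x "Suc b" b] xy by auto
    obtain d where d: "runs d x y (Suc b) g qg"
      using qg[of x "Suc b" y] xy by auto
    obtain e where e: "runs e x y (Suc b) h qh"
      using qh[of x "Suc b" y] xy by auto
    let ?c = "Seq c (Cond (Var b) d e)"
    have "\<exists>n t. exec ?c s n t \<and> t y = (if f (s x) \<noteq> Leaf then g (s x) else h (s x)) \<and>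
        (\<forall>z<b. z \<noteq> y \<longrightarrow> t z = s z) \<and> n \<le> poly q (size (s x))" for s
    proof -
      obtain m s1 where 1: "exec c s m s1" "s1 b = f (s x)"
        "\<And>z. z < Suc b \<Longrightarrow> z \<noteq> b \<Longrightarrow> s1 z = s z" "m \<le> poly qf (size (s x))"
        using runsE[OF c, of s] by metis
      have v: "s1 x = s x" using 1 xy by auto
      obtain n t where 2: "exec (Cond (Var b) d e) s1 (1 + cost (Var b) s1 + n) t"
        "t y = (if f (s x) \<noteq> Leaf then g (s x) else h (s x))"
        "\<And>z. z < Suc b \<Longrightarrow> z \<noteq> y \<Longrightarrow> t z = s1 z" "n \<le> poly (qg + qh) (size (s x))"
      proof (cases "f (s x) = Leaf")
        case True
        obtain n t where *: "exec e s1 n t" "t y = h (s1 x)"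
          "\<And>z. z < Suc b \<Longrightarrow> z \<noteq> y \<Longrightarrow> t z = s1 z" "n \<le> poly qh (size (s1 x))"
          using runsE[OF e, of s1] by metis
        from True have "val (Var b) s1 = Leaf" using 1 by simp
        from exec.CondFalse[OF this *(1)] show ?thesis
          using True * v that by (metis poly_add trans_le_add2)
      next
        case False
        obtain n t where *: "exec d s1 n t" "t y = g (s1 x)"
          "\<And>z. z < Suc b \<Longrightarrow> z \<noteq> y \<Longrightarrow> t z = s1 z" "n \<le> poly qg (size (s1 x))"
          using runsE[OF d, of s1] by metis
        from False have "val (Var b) s1 \<noteq> Leaf" using 1 by simp
        from exec.CondTrue[OF this *(1)] show ?thesis
          using False * v that by (metis poly_add trans_le_add1)
      qed
      have ex: "exec ?c s (1 + m + (1 + cost (Var b) s1 + n)) t"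
        using 1(1) 2(1) by (rule exec.Seq)
      have "1 + m + (1 + cost (Var b) s1 + n) \<le> poly q (size (s x))"
        using 1(2,4) 2(4) rf[of "s x"] by (simp add: q_def)
      moreover have "t z = s z" if "z < b" "z \<noteq> y" for z
        using 1(3) 2(3) that by simp
      ultimately show ?thesis using ex 2(2) by blast
    qed
    then show ?thesis unfolding runs_def by blast
  qed
  then show ?thesis unfolding ptime_def by blast
qed

section \<open>Folds over lists at polynomial cost\<close>

fun foldT :: "(bt \<Rightarrow> bt \<Rightarrow> bt) \<Rightarrow> bt \<Rightarrow> bt \<Rightarrow> bt" where
  "foldT F Leaf a = a"
| "foldT F (Fork h l) a = foldT F l (F h a)"

text \<open>Register \<open>b\<close> holds the unread list, \<open>b + 1\<close> the accumulator
  and \<open>b + 2\<close> the packed argument of the loop body. The potential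
  \<open>(c + 1) * size (s b) + size (s (b + 1))\<close> never increases, so \<open>N\<close> bounds
  all accumulators. There are at most \<open>size (s b)\<close> rounds, each within the bracketed
  bound.\<close>

lemma exec_fold_loop:
  assumes F: "runs d (b + 2) (b + 1) (b + 3) (\<lambda>y. F (left y) (left (right y)) (right (right y))) qF"
    and size: "\<And>h a. size (F v h a) \<le> size a + size h + c"
    and "x < b" "s x = v" "(c + 1) * size (s b) + size (s (b + 1)) \<le> N"
  shows "\<exists>n t. exec (While (Var b)
      (Seq (Assign (b + 2) (ForkE (Var x) (ForkE (Left (Var b)) (Var (b + 1)))))
      (Seq d (Assign b (Right (Var b)))))) s n t \<and>
    t (b + 1) = foldT (F v) (s b) (s (b + 1)) \<and> (\<forall>z<b. t z = s z) \<and>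
    n \<le> 2 + N + size (s b) * (30 + 3 * size v + 10 * N + poly qF (2 + size v + N))"
  using assms(3-)
proof (induction "s b" arbitrary: s)
  case Leaf
  let ?w = "While (Var b)
      (Seq (Assign (b + 2) (ForkE (Var x) (ForkE (Left (Var b)) (Var (b + 1)))))
      (Seq d (Assign b (Right (Var b)))))"
  have "exec ?w s (1 + cost (Var b) s) s"
    using Leaf by (intro exec.WhileFalse) simp
  then show ?case using Leaf.hyps[symmetric] by (intro exI[of _ s] exI) auto
next
  case (Fork h l)
  let ?e = "ForkE (Var x) (ForkE (Left (Var b)) (Var (b + 1)))"
  let ?w = "While (Var b) (Seq (Assign (b + 2) ?e) (Seq d (Assign b (Right (Var b)))))"
  define B where "B = 30 + 3 * size v + 10 * N + poly qF (2 + size v + N)"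
  define s1 where "s1 = s(b + 2 := val ?e s)"
  have sb: "s b = Fork h l" using Fork.hyps by simp
  obtain n s2 where 2: "exec d s1 n s2"
    "s2 (b + 1) = F (left (s1 (b + 2))) (left (right (s1 (b + 2)))) (right (right (s1 (b + 2))))"
    "\<And>z. z < b + 3 \<Longrightarrow> z \<noteq> b + 1 \<Longrightarrow> s2 z = s1 z" "n \<le> poly qF (size (s1 (b + 2)))"
    using runsE[OF F, of s1] by metis
  define s3 where "s3 = s2(b := val (Right (Var b)) s2)"
  have sh: "size h + size l + size (s (b + 1)) + 1 \<le> N"
    using Fork.prems(3) sb by (simp add: algebra_simps)
  have s1b: "s1 (b + 2) = Fork v (Fork h (s (b + 1)))"
    using Fork.prems sb by (simp add: s1_def)
  have n: "n \<le> poly qF (2 + size v + N)"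
  proof -
    have "size (s1 (b + 2)) \<le> 2 + size v + N" unfolding s1b using sh by simp
    then show ?thesis using 2(4) poly_nat_mono le_trans by blast
  qed
  have s2b: "s2 b = Fork h l" using 2(3)[of b] sb by (simp add: s1_def)
  have s3: "s3 b = l" "s3 (b + 1) = F v h (s (b + 1))"
    using s2b 2(2) s1b by (simp_all add: s3_def)
  have s3s: "s3 z = s z" if "z < b" for z
    using 2(3)[of z] that by (simp add: s3_def s1_def)
  \<comment> \<open>Consuming the cell of \<open>h\<close> frees
    \<open>(c + 1) * (size h + 1)\<close>, which pays for the growth of the accumulator by at most
    \<open>size h + c\<close>.\<close>
  have "(c + 1) * size (s3 b) + size (s3 (b + 1)) \<le> N"
    using Fork.prems(3) sb s3 size[of h "s (b + 1)"] by (simp add: algebra_simps)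
  then obtain m t where t: "exec ?w s3 m t" "t (b + 1) = foldT (F v) l (F v h (s (b + 1)))"
    "\<forall>z<b. t z = s3 z" "m \<le> 2 + N + size l * B"
    using Fork(2)[of s3] Fork.prems s3 s3s unfolding B_def by auto
  have body: "exec (Seq (Assign (b + 2) ?e) (Seq d (Assign b (Right (Var b))))) s
     (1 + (1 + cost ?e s) + (1 + n + (1 + cost (Right (Var b)) s2))) s3"
    unfolding s3_def using 2(1) unfolding s1_def
    by (rule exec.Seq[OF exec.Assign exec.Seq[OF _ exec.Assign]])
  have "val (Var b) s \<noteq> Leaf" using sb by simp
  from exec.WhileTrue[OF this body t(1)]
  have ex: "exec ?w s (1 + cost (Var b) s +
      (1 + (1 + cost ?e s) + (1 + n + (1 + cost (Right (Var b)) s2))) + m) t" .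
  have "1 + cost (Var b) s + (1 + (1 + cost ?e s) + (1 + n + (1 + cost (Right (Var b)) s2))) \<le> B"
    using sh n Fork.prems(2) sb s2b unfolding B_def by simp
  then have "1 + cost (Var b) s +
      (1 + (1 + cost ?e s) + (1 + n + (1 + cost (Right (Var b)) s2))) + m \<le> 2 + N + size (s b) * B"
    using t(4) sb by (simp add: algebra_simps)
  then show ?case using ex t sb s3s unfolding B_def[symmetric]
    by (intro exI[of _ t] exI) (auto intro: ex)
qed

text \<open>The additive growth bound is essential: a step that doubled the accumulator would
  produce exponentially large data. The step may depend on the whole input \<open>x\<close>, which
  stays in its register during the loop.\<close>

lemma ptime_foldT:
  assumes F: "ptime (\<lambda>y. F (left y) (left (right y)) (right (right y)))"
    and l: "ptime l" and i: "ptime i"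
    and size: "\<And>x h a. size (F x h a) \<le> size a + size h + c"
  shows "ptime (\<lambda>x. foldT (F x) (l x) (i x))"
proof -
  let ?F = "\<lambda>y. F (left y) (left (right y)) (right (right y))"
  obtain qF where qF: "\<And>x y b. x < b \<Longrightarrow> y < b \<Longrightarrow> \<exists>c. runs c x y b ?F qF"
    using F unfolding ptime_def by blast
  obtain ql where ql: "\<And>x y b. x < b \<Longrightarrow> y < b \<Longrightarrow> \<exists>c. runs c x y b l ql"
    using l unfolding ptime_def by blast
  obtain qi where qi: "\<And>x y b. x < b \<Longrightarrow> y < b \<Longrightarrow> \<exists>c. runs c x y b i qi"
    using i unfolding ptime_def by blast
  obtain rl where rl: "\<And>v. size (l v) \<le> poly rl (size v)"
    using ptime_size[OF l] by blast
  obtain ri where ri: "\<And>v. size (i v) \<le> poly ri (size v)"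
    using ptime_size[OF i] by blast
  \<comment> \<open>A polynomial bound on the initial potential, and hence on the final
    accumulator.\<close>
  define N where "N = [:c + 1:] * rl + ri"
  define q where "q = [:10:] + ql + qi + N + N +
    rl * ([:30:] + [:3:] * [:0, 1:] + [:10:] * N + pcompose qF ([:2, 1:] + N))"
  have sizeF: "size (foldT (F v) w a) \<le> (c + 1) * size w + size a" for v w a
  proof (induction w arbitrary: a)
    case (Fork h w)
    then show ?case using size[of v h a] Fork(2)[of "F v h a"] by (simp add: algebra_simps)
  qed simp
  have "\<exists>c. runs c x y b (\<lambda>x. foldT (F x) (l x) (i x)) q" if xy: "x < b" "y < b" for x y b
  proof -
    obtain cl where cl: "runs cl x b (b + 1) l ql"
      using ql[of x "b + 1" b] xy by auto
    obtain ci where ci: "runs ci x (b + 1) (b + 2) i qi"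
      using qi[of x "b + 2" "b + 1"] xy by auto
    obtain d where d: "runs d (b + 2) (b + 1) (b + 3) ?F qF"
      using qF[of "b + 2" "b + 3" "b + 1"] by auto
    let ?w = "While (Var b)
      (Seq (Assign (b + 2) (ForkE (Var x) (ForkE (Left (Var b)) (Var (b + 1)))))
      (Seq d (Assign b (Right (Var b)))))"
    let ?c = "Seq cl (Seq ci (Seq ?w (Assign y (Var (b + 1)))))"
    have "\<exists>n t. exec ?c s n t \<and> t y = foldT (F (s x)) (l (s x)) (i (s x)) \<and>
        (\<forall>z<b. z \<noteq> y \<longrightarrow> t z = s z) \<and> n \<le> poly q (size (s x))" for s
    proof -
      define v where "v = s x"
      obtain n1 s1 where 1: "exec cl s n1 s1" "s1 b = l v"
        "\<And>z. z < b + 1 \<Longrightarrow> z \<noteq> b \<Longrightarrow> s1 z = s z" "n1 \<le> poly ql (size v)"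
        using runsE[OF cl, of s] unfolding v_def by metis
      obtain n2 s2 where 2: "exec ci s1 n2 s2" "s2 (b + 1) = i (s1 x)"
        "\<And>z. z < b + 2 \<Longrightarrow> z \<noteq> b + 1 \<Longrightarrow> s2 z = s1 z" "n2 \<le> poly qi (size (s1 x))"
        using runsE[OF ci, of s1] by metis
      have s2: "s1 x = v" "s2 x = v" "s2 b = l v" "s2 (b + 1) = i v" "\<And>z. z < b \<Longrightarrow> s2 z = s z"
        using 1 2 xy by (auto simp: v_def)
      define M where "M = poly N (size v)"
      have M: "(c + 1) * size (l v) + size (i v) \<le> M"
        using mult_le_mono2[OF rl[of v], of "c + 1"] ri[of v] by (simp add: M_def N_def)
      then obtain n3 s3 where 3: "exec ?w s2 n3 s3" "s3 (b + 1) = foldT (F v) (l v) (i v)"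
        "\<forall>z<b. s3 z = s2 z"
        "n3 \<le> 2 + M + size (l v) * (30 + 3 * size v + 10 * M + poly qF (2 + size v + M))"
        using exec_fold_loop[OF d size xy(1), of s2 v M] s2 by auto
      let ?t = "s3(y := val (Var (b + 1)) s3)"
      have ex: "exec ?c s (1 + n1 + (1 + n2 + (1 + n3 + (1 + cost (Var (b + 1)) s3)))) ?t"
        by (intro exec.Seq[OF 1(1)] exec.Seq[OF 2(1)] exec.Seq[OF 3(1)] exec.Assign)
      have "n3 \<le> 2 + M + poly rl (size v) * (30 + 3 * size v + 10 * M + poly qF (2 + size v + M))"
        by (rule le_trans[OF 3(4)]) (use rl[of v] in auto)
      moreover have "size (s3 (b + 1)) \<le> M" using sizeF[of v "l v" "i v"] M 3(2) by simp
      moreover have "n2 \<le> poly qi (size v)" using 2(4) s2(1) by simp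
      ultimately have "1 + n1 + (1 + n2 + (1 + n3 + (1 + cost (Var (b + 1)) s3))) \<le> poly q (size v)"
        using 1(4) by (simp add: q_def poly_pcompose M_def algebra_simps)
      then show ?thesis using ex 3(2,3) s2(5) v_def
        by (intro exI[of _ ?t] exI) (auto intro: ex)
    qed
    then show ?thesis unfolding runs_def by blast
  qed
  then show ?thesis unfolding ptime_def by blast
qed


section \<open>The reduction on encoded instances\<close>

fun foldrT :: "(bt \<Rightarrow> bt \<Rightarrow> bt) \<Rightarrow> bt \<Rightarrow> bt \<Rightarrow> bt" where
  "foldrT F Leaf a = a"
| "foldrT F (Fork h l) a = F h (foldrT F l a)"

text \<open>Folding with \<open>Fork\<close> pushes \<open>l\<close> in reverse order onto
  \<open>r\<close>. With \<open>r = Leaf\<close> this turns a right fold into two left folds, which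
  the loop can execute.\<close>

lemma foldT_foldT_Fork: "foldT F (foldT Fork l r) a = foldT F r (foldrT F l a)"
  by (induction l arbitrary: r) auto

lemma ptime_foldrT:
  assumes "ptime (\<lambda>y. F (left y) (left (right y)) (right (right y)))"
    and l: "ptime l" and "ptime i"
    and "\<And>x h a. size (F x h a) \<le> size a + size h + c"
  shows "ptime (\<lambda>x. foldrT (F x) (l x) (i x))"
proof -
  have "ptime (\<lambda>x. foldT Fork (l x) Leaf)"
    by (rule ptime_foldT[where c = 1]) (auto intro!: ptime_Fork ptime_left ptime_right ptime_id ptime_Leaf l)
  from ptime_foldT[OF assms(1) this assms(3,4)] show ?thesis
    by (simp add: foldT_foldT_Fork)
qed

lemma size_foldT_le:
  assumes "\<And>h a. size (F h a) \<le> size a"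
  shows "size (foldT F l a) \<le> size a"
proof (induction l arbitrary: a)
  case (Fork h l)
  then show ?case using assms[of h a] by (auto intro: le_trans)
qed simp

text \<open>A right fold keeps the order of the list, so that sorted lists stay sorted, as the
  encoding of instances requires.\<close>

definition filterT :: "(bt \<Rightarrow> bt) \<Rightarrow> bt \<Rightarrow> bt" where
  "filterT P l = foldrT (\<lambda>h a. if P h \<noteq> Leaf then Fork h a else a) l Leaf"

lemma size_filterT: "size (filterT P l) \<le> size l"
  unfolding filterT_def by (induction l) auto

lemmas ptime_rules = ptime_id ptime_Leaf ptime_left ptime_right ptime_Fork ptime_eq ptime_if

lemma ptime_filterT:
  assumes P: "ptime (\<lambda>y. P (left y) (right y))" and l: "ptime l"
  shows "ptime (\<lambda>x. filterT (P x) (l x))"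
  unfolding filterT_def
  by (rule ptime_foldrT[where c = 1]) (intro ptime_app2[OF P] ptime_rules l | simp)+

section \<open>Arithmetic by folds\<close>

text \<open>A higher bit overrides the lower ones: equal bits keep the outcome so far, different
  bits replace it by the bit of the second number. If that number is exhausted,
  \<open>left Leaf\<close> supplies the bit 0.\<close>

definition leq_step :: "bt \<Rightarrow> bt \<Rightarrow> bt" where
  "leq_step h a = Fork (right (left a))
    (if enc_bool (h = left (left a)) \<noteq> Leaf then right a else left (left a))"

text \<open>
  Both numbers are read from the least significant bit on; the accumulator pairs the unread part of
  the second number with the outcome of the comparison of the parts read.
\<close>

definition leqT :: "bt \<Rightarrow> bt \<Rightarrow> bt" where
  "leqT m n =
    (if left (foldT leq_step m (Fork n (Fork Leaf Leaf))) \<noteq> Leaf then Fork Leaf Leaf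
     else right (foldT leq_step m (Fork n (Fork Leaf Leaf))))"

lemma size_leq_step: "size (leq_step h a) \<le> size a + size h + 1"
  unfolding leq_step_def by (cases a; cases "left a") auto

lemma ptime_leqT:
  assumes f: "ptime f" and g: "ptime g"
  shows "ptime (\<lambda>x. leqT (f x) (g x))"
proof -
  have "ptime (\<lambda>x. foldT leq_step (f x) (Fork (g x) (Fork Leaf Leaf)))"
  proof (rule ptime_foldT[where c = 1])
    show "ptime (\<lambda>y. leq_step (left (right y)) (right (right y)))"
      unfolding leq_step_def by (intro ptime_rules)
  qed (intro ptime_rules f g size_leq_step)+
  then show ?thesis
    unfolding leqT_def by (intro ptime_rules)
qed

text \<open>On lengths this is truncated subtraction, so a test for \<open>Leaf\<close> compares two
  lengths.\<close>

definition dropT :: "bt \<Rightarrow> bt \<Rightarrow> bt" where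
  "dropT u l = foldT (\<lambda>h a. right a) u l"

lemma size_dropT: "size (dropT u l) \<le> size l"
  unfolding dropT_def by (rule size_foldT_le) (rule size_right)

lemma ptime_dropT:
  assumes f: "ptime f" and g: "ptime g"
  shows "ptime (\<lambda>x. dropT (f x) (g x))"
  unfolding dropT_def
  by (rule ptime_foldT[where c = 0]) (intro ptime_rules f g | simp add: size_right trans_le_add1)+

text \<open>The pair consists of a unary counter and a reservoir. Incrementing takes a cell from the
  reservoir, so the total length is constant and the counter saturates when the reservoir is
  empty.\<close>

definition moveT :: "bt \<Rightarrow> bt" where
  "moveT a = (if right a \<noteq> Leaf then Fork (Fork Leaf (left a)) (right (right a)) else a)"

definition doubleT :: "bt \<Rightarrow> bt" where
  "doubleT a = foldT (\<lambda>h. moveT) (left a) a"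

text \<open>
  The value of a binary number in unary, capped at the length of a given list. By Horner's scheme,
  moving elements from the list to the result, so that no intermediate value can become large.
\<close>

definition capT :: "bt \<Rightarrow> bt \<Rightarrow> bt" where
  "capT k l = left (foldrT (\<lambda>b a. if b \<noteq> Leaf then moveT (doubleT a) else doubleT a) k (Fork Leaf l))"

lemma size_moveT: "size (moveT a) \<le> size a"
  unfolding moveT_def by (cases a; cases "right a") auto

lemma size_doubleT: "size (doubleT a) \<le> size a"
  unfolding doubleT_def by (rule size_foldT_le) (rule size_moveT)

lemma ptime_moveT: "ptime f \<Longrightarrow> ptime (\<lambda>x. moveT (f x))"
  unfolding moveT_def by (intro ptime_rules)

lemma ptime_doubleT:
  assumes f: "ptime f"
  shows "ptime (\<lambda>x. doubleT (f x))"
  unfolding doubleT_def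
  by (rule ptime_foldT[where c = 0])
    (intro ptime_rules ptime_moveT f | simp add: size_moveT trans_le_add1)+

lemma ptime_capT:
  assumes f: "ptime f" and g: "ptime g"
  shows "ptime (\<lambda>x. capT (f x) (g x))"
proof -
  have "size (if b \<noteq> Leaf then moveT (doubleT a) else doubleT a) \<le> size a + size b + 0" for a b
    using size_moveT[of "doubleT a"] size_doubleT[of a] by simp
  then show ?thesis
    unfolding capT_def
    by (intro ptime_left ptime_foldrT[where c = 0] ptime_rules ptime_moveT ptime_doubleT f g)
qed

section \<open>The reduction as a function on trees\<close>

definition hitT :: "bt \<Rightarrow> bt \<Rightarrow> bt \<Rightarrow> bt" where
  "hitT x a e =
    (if enc_bool (x = left (left e)) \<noteq> Leaf then leqT a (left (right e))
     else if enc_bool (x = right (left e)) \<noteq> Leaf then leqT a (right (right e)) else Leaf)"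

text \<open>
  Below, \<open>u\<close> is \<open>min k m\<close> in unary, where \<open>m\<close> bounds the length of \<open>S\<close>.  A unary \<open>k\<close> could be
  exponentially large, and the cap does not change the outcome of the comparisons.
\<close>

definition busyT :: "bt \<Rightarrow> bt \<Rightarrow> bt \<Rightarrow> bt \<Rightarrow> bt" where
  "busyT u x a S = dropT u (right (filterT (hitT x a) S))"

definition redundantT :: "bt \<Rightarrow> bt \<Rightarrow> bt \<Rightarrow> bt" where
  "redundantT u e S =
    (if busyT u (left (left e)) (left (right e)) S \<noteq> Leaf then Fork Leaf Leaf
     else busyT u (right (left e)) (right (right e)) S)"

definition removeT :: "bt \<Rightarrow> bt \<Rightarrow> bt" where
  "removeT e S = filterT (\<lambda>f. if enc_bool (f = e) \<noteq> Leaf then Leaf else Fork Leaf Leaf) S"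

definition pruneT :: "bt \<Rightarrow> bt \<Rightarrow> bt" where
  "pruneT u E = foldrT (\<lambda>e S. if redundantT u e S \<noteq> Leaf then removeT e S else S) E E"

text \<open>Each round removes one element more than \<open>u\<close> has, which compares the length
  of \<open>S\<close> with a product without computing that product.\<close>

definition manyT :: "bt \<Rightarrow> bt \<Rightarrow> bt" where
  "manyT u S = foldT (\<lambda>h K. dropT u (right K)) u S"

definition touchT :: "bt \<Rightarrow> bt \<Rightarrow> bt" where
  "touchT S x = filterT (\<lambda>e. if enc_bool (x = left (left e)) \<noteq> Leaf then Fork Leaf Leaf
    else enc_bool (x = right (left e))) S"

text \<open>In the first case, the output is the empty graph with budget \<open>-1\<close>.\<close>

definition finishT :: "bt \<Rightarrow> bt \<Rightarrow> bt \<Rightarrow> bt \<Rightarrow> bt \<Rightarrow> bt" where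
  "finishT V u S k P =
    (if manyT u S \<noteq> Leaf
     then Fork (Fork Leaf Leaf) (Fork k (Fork (Fork Leaf Leaf) (Fork (Fork Leaf Leaf) Leaf)))
     else Fork (Fork (filterT (touchT S) V) S) (Fork k P))"

definition kernelT :: "bt \<Rightarrow> bt" where
  "kernelT x =
    finishT (left (left x)) (capT (left (right x)) (right (left x)))
      (pruneT (capT (left (right x)) (right (left x))) (right (left x)))
      (left (right x)) (right (right x))"

section \<open>Polynomial time of the reduction\<close>

lemma ptime_hitT:
  assumes "ptime f" "ptime g" "ptime h"
  shows "ptime (\<lambda>x. hitT (f x) (g x) (h x))"
  unfolding hitT_def by (intro ptime_rules ptime_leqT assms)

lemma ptime_busyT:
  assumes f: "ptime f" and g: "ptime g" and h: "ptime h" and j: "ptime j"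
  shows "ptime (\<lambda>x. busyT (f x) (g x) (h x) (j x))"
  unfolding busyT_def
  by (intro ptime_dropT ptime_filterT ptime_hitT ptime_rules ptime_comp[OF g] ptime_comp[OF h] f j)

lemma ptime_redundantT:
  assumes "ptime f" "ptime g" "ptime h"
  shows "ptime (\<lambda>x. redundantT (f x) (g x) (h x))"
  unfolding redundantT_def by (intro ptime_rules ptime_busyT assms)

lemma ptime_removeT:
  assumes f: "ptime f" and g: "ptime g"
  shows "ptime (\<lambda>x. removeT (f x) (g x))"
  unfolding removeT_def by (intro ptime_filterT ptime_rules ptime_comp[OF f] g)

lemma ptime_pruneT:
  assumes f: "ptime f" and g: "ptime g"
  shows "ptime (\<lambda>x. pruneT (f x) (g x))"
  unfolding pruneT_def
  by (rule ptime_foldrT[where c = 0])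
    (intro ptime_rules ptime_redundantT ptime_removeT ptime_comp[OF f] g
      | simp add: removeT_def size_filterT trans_le_add1)+

lemma ptime_manyT:
  assumes f: "ptime f" and g: "ptime g"
  shows "ptime (\<lambda>x. manyT (f x) (g x))"
proof -
  have "size (dropT u (right a)) \<le> size a + size h + 0" for u a h
    using size_dropT[of u "right a"] size_right[of a] by simp
  then show ?thesis
    unfolding manyT_def
    by (intro ptime_foldT[where c = 0] ptime_rules ptime_dropT ptime_comp[OF f] f g)
qed

lemma ptime_touchT:
  assumes f: "ptime f" and g: "ptime g"
  shows "ptime (\<lambda>x. touchT (f x) (g x))"
  unfolding touchT_def by (intro ptime_filterT ptime_rules ptime_comp[OF g] f)

lemma ptime_finishT:
  assumes f: "ptime f" and g: "ptime g" and h: "ptime h" and i: "ptime i" and j: "ptime j"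
  shows "ptime (\<lambda>x. finishT (f x) (g x) (h x) (i x) (j x))"
  unfolding finishT_def
  by (intro ptime_rules ptime_manyT ptime_filterT ptime_touchT ptime_comp[OF h] f g h i j)

lemma ptime_kernelT: "ptime kernelT"
proof -
  have "ptime (\<lambda>x. kernelT x)"
    unfolding kernelT_def by (intro ptime_finishT ptime_capT ptime_pruneT ptime_rules)
  then show ?thesis .
qed

section \<open>List lengths under the unary operations\<close>

fun lenT :: "bt \<Rightarrow> nat" where
  "lenT Leaf = 0"
| "lenT (Fork h l) = Suc (lenT l)"

lemma lenT_eq_0: "lenT l = 0 \<longleftrightarrow> l = Leaf"
  by (cases l) auto

lemma lenT_enc_list [simp]: "lenT (enc_list e xs) = length xs"
  by (induction xs) auto

lemma lenT_right: "lenT (right l) = lenT l - 1"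
  by (cases l) auto

lemma lenT_dropT: "lenT (dropT u l) = lenT l - lenT u"
  unfolding dropT_def by (induction u arbitrary: l) (auto simp: lenT_right)

lemma lenT_manyT: "lenT (manyT u S) = lenT S - lenT u * Suc (lenT u)"
proof -
  \<comment> \<open>The list that counts the rounds is separated from the \<open>u\<close> dropped
    in each round, so that the induction varies only the former.\<close>
  have "lenT (foldT (\<lambda>h K. dropT u (right K)) v S) = lenT S - lenT v * Suc (lenT u)" for v
    by (induction v arbitrary: S) (auto simp: lenT_right lenT_dropT)
  then show ?thesis by (simp add: manyT_def)
qed

lemma lenT_moveT:
  "lenT (left (moveT a)) = min (Suc (lenT (left a))) (lenT (left a) + lenT (right a))"
  "lenT (right (moveT a)) = lenT (right a) - 1"
  unfolding moveT_def using lenT_eq_0[of "right a"] by (auto simp: lenT_right)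

lemma lenT_doubleT:
  "lenT (left (doubleT a)) = min (2 * lenT (left a)) (lenT (left a) + lenT (right a))"
  "lenT (right (doubleT a)) = lenT (right a) - lenT (left a)"
proof -
  have "lenT (left (foldT (\<lambda>h. moveT) u a)) =
      min (lenT (left a) + lenT u) (lenT (left a) + lenT (right a)) \<and>
    lenT (right (foldT (\<lambda>h. moveT) u a)) = lenT (right a) - lenT u" for u
    by (induction u arbitrary: a) (auto simp: lenT_moveT min_def)
  then show "lenT (left (doubleT a)) = min (2 * lenT (left a)) (lenT (left a) + lenT (right a))"
    "lenT (right (doubleT a)) = lenT (right a) - lenT (left a)"
    by (auto simp: doubleT_def)
qed

section \<open>Binary numbers\<close>

lemma enc_bool_eq_Leaf [simp]: "enc_bool b = Leaf \<longleftrightarrow> \<not> b"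
  by (simp add: enc_bool_def)

lemma enc_bool_inj [simp]: "enc_bool b = enc_bool b' \<longleftrightarrow> b = b'"
  by (auto simp: enc_bool_def)

lemma enc_nat_0 [simp]: "enc_nat 0 = Leaf"
  by (simp add: enc_nat.simps)

lemma enc_nat_pos: "n > 0 \<Longrightarrow> enc_nat n = Fork (enc_bool (odd n)) (enc_nat (n div 2))"
  by (subst enc_nat.simps) simp

lemma enc_nat_eq_Leaf [simp]: "enc_nat n = Leaf \<longleftrightarrow> n = 0"
  by (subst enc_nat.simps) simp

lemma left_enc_nat: "left (enc_nat n) = enc_bool (odd n)"
  by (subst enc_nat.simps) (simp add: enc_bool_def)

lemma right_enc_nat: "right (enc_nat n) = enc_nat (n div 2)"
  by (subst enc_nat.simps) simp

lemma nat_eq_iff_bits: "(m :: nat) = n \<longleftrightarrow> odd m = odd n \<and> m div 2 = n div 2"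
  by (metis dvd_mult_div_cancel odd_two_times_div_two_succ)

lemma enc_nat_inj [simp]: "enc_nat m = enc_nat n \<longleftrightarrow> m = n"
proof (induction m arbitrary: n rule: less_induct)
  case (less m)
  show ?case
  proof (cases "m = 0 \<or> n = 0")
    case True
    then show ?thesis by (metis enc_nat_eq_Leaf)
  next
    case False
    then show ?thesis
      using less[of "m div 2" "n div 2"] nat_eq_iff_bits[of m n] by (simp add: enc_nat_pos)
  qed
qed

text \<open>Capping at \<open>lenT l\<close> commutes with doubling and incrementing, so the capped
  Horner scheme ends in the capped value. The induction also tracks the reservoir, because together
  with the counter it determines where saturation occurs.\<close>

lemma lenT_capT: "lenT (capT (enc_nat k) l) = min k (lenT l)"
proof -
  let ?r = "\<lambda>n. foldrT (\<lambda>b a. if b \<noteq> Leaf then moveT (doubleT a) else doubleT a) (enc_nat n) (Fork Leaf l)"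
  have "lenT (left (?r n)) = min n (lenT l) \<and> lenT (right (?r n)) = lenT l - n" for n
  proof (induction n rule: less_induct)
    case (less n)
    show ?case
    proof (cases "n = 0")
      case False
      define a where "a = ?r (n div 2)"
      have "lenT (left a) = min (n div 2) (lenT l)" "lenT (right a) = lenT l - n div 2"
        using less[of "n div 2"] False unfolding a_def by auto
      then have "lenT (left (doubleT a)) = min (2 * (n div 2)) (lenT l)"
        "lenT (right (doubleT a)) = lenT l - 2 * (n div 2)"
        unfolding lenT_doubleT by (auto simp: min_def)
      moreover have "?r n = (if odd n then moveT (doubleT a) else doubleT a)"
        using False by (simp add: enc_nat_pos a_def)
      ultimately show ?thesis
        by (cases "odd n") (auto simp: lenT_moveT elim!: oddE)
    qed simp
  qed
  then show ?thesis by (simp add: capT_def)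
qed

text \<open>The induction allows any outcome \<open>c\<close> for the bits already read: the unread
  parts decide, and \<open>c\<close> counts only on a tie. Starting from \<open>True\<close> gives
  the non-strict comparison. When \<open>m\<close> is used up, a nonempty rest of \<open>n\<close>
  means that \<open>n\<close> is larger.\<close>

lemma leqT_enc_nat: "leqT (enc_nat m) (enc_nat n) = enc_bool (m \<le> n)"
proof -
  define res where "res r = (if left r \<noteq> Leaf then Fork Leaf Leaf else right r)" for r
  \<comment> \<open>Comparison with remainder: the last bits \<open>i\<close> and \<open>j\<close>
    matter only if the halves agree, and \<open>c\<close> only if these bits agree as well.\<close>
  have bits: "a < b \<or> a = b \<and> (if i = j then c else j) \<longleftrightarrow>
      2 * a + of_bool i < 2 * b + of_bool j \<or> 2 * a + of_bool i = 2 * b + of_bool j \<and> c"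
    for a b :: nat and i j c
    by (cases c; cases i; cases j; simp; arith)
  have "res (foldT leq_step (enc_nat m) (Fork (enc_nat n) (enc_bool c))) =
      enc_bool (m < n \<or> m = n \<and> c)" for c
  proof (induction m arbitrary: n c rule: less_induct)
    case (less m)
    show ?case
    proof (cases "m = 0")
      case True
      then show ?thesis by (auto simp: res_def enc_bool_def)
    next
      case False
      have step: "leq_step (enc_bool (odd m)) (Fork (enc_nat n) (enc_bool c)) =
          Fork (enc_nat (n div 2)) (enc_bool (if odd m = odd n then c else odd n))"
        by (auto simp: leq_step_def left_enc_nat right_enc_nat)
      have "m div 2 < n div 2 \<or> m div 2 = n div 2 \<and> (if odd m = odd n then c else odd n) \<longleftrightarrow>
          m < n \<or> m = n \<and> c"
        using bits[of "m div 2" "n div 2" "odd m" "odd n" c]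
        by (simp only: mod_2_eq_odd[symmetric] mult_div_mod_eq)
      then show ?thesis
        using False less[of "m div 2" "n div 2"] by (simp add: enc_nat_pos[of m] step)
    qed
  qed
  from this[of True] show ?thesis
    by (simp add: leqT_def res_def enc_bool_def le_less)
qed

lemma enc_edge_inj [simp]: "enc_edge w e = enc_edge w f \<longleftrightarrow> e = f"
  by (auto simp: enc_edge_def split: prod.splits)

lemma filterT_enc_list:
  assumes "\<And>x. x \<in> set xs \<Longrightarrow> P (e x) \<noteq> Leaf \<longleftrightarrow> p x"
  shows "filterT P (enc_list e xs) = enc_list e (filter p xs)"
  using assms unfolding filterT_def by (induction xs) auto

section \<open>Pruning edges\<close>

definition hit :: "(nat \<Rightarrow> nat \<Rightarrow> nat) \<Rightarrow> nat \<Rightarrow> nat \<Rightarrow> nat \<times> nat \<Rightarrow> bool" where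
  "hit w x a = (\<lambda>(u, v). x = u \<and> a \<le> w u v \<or> x = v \<and> a \<le> w v u)"

text \<open>An edge of a duplicate-free \<open>S\<close> is itself one of the hits at its own
  weight, so more than \<open>Suc k\<close> hits leave at least \<open>k + 1\<close> other
  edges.\<close>

definition redundant :: "(nat \<Rightarrow> nat \<Rightarrow> nat) \<Rightarrow> nat \<Rightarrow> (nat \<times> nat) list \<Rightarrow> nat \<times> nat \<Rightarrow> bool" where
  "redundant w k S = (\<lambda>(u, v).
    Suc k < length (filter (hit w u (w u v)) S) \<or> Suc k < length (filter (hit w v (w v u)) S))"

definition prune_step ::
  "(nat \<Rightarrow> nat \<Rightarrow> nat) \<Rightarrow> nat \<Rightarrow> nat \<times> nat \<Rightarrow> (nat \<times> nat) list \<Rightarrow> (nat \<times> nat) list" where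
  "prune_step w k e S = (if redundant w k S e then filter (\<lambda>f. f \<noteq> e) S else S)"

text \<open>The predicate depends on the course of the pruning, so only its existence is claimed.
  This suffices to pass on distinctness, sortedness and length bounds.\<close>

lemma prune_filter: "\<exists>Q. foldr (prune_step w k) es S = filter Q S"
proof (induction es)
  case Nil
  show ?case by (auto intro: exI[of _ "\<lambda>_. True"])
next
  case (Cons e es)
  then obtain Q where Q: "foldr (prune_step w k) es S = filter Q S" by blast
  have "prune_step w k e (filter Q S) =
      filter (if redundant w k (filter Q S) e then \<lambda>f. Q f \<and> f \<noteq> e else Q) S"
    by (simp add: prune_step_def conj_commute)
  then show ?case using Q by auto
qed

lemma redundant_filter: "redundant w k (filter Q S) e \<Longrightarrow> redundant w k S e"
proof -
  have "length (filter P (filter Q S)) \<le> length (filter P S)" for P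
    by (induction S) auto
  then show "redundant w k (filter Q S) e \<Longrightarrow> redundant w k S e"
    unfolding redundant_def by (auto dest: less_le_trans split: prod.splits)
qed

text \<open>A surviving edge was irredundant when it was tested. Later deletions only lower the
  counts of hits, so it stays irredundant and one pass is enough.\<close>

lemma prune_irredundant:
  "e \<in> set es \<Longrightarrow> e \<in> set (foldr (prune_step w k) es S) \<Longrightarrow>
    \<not> redundant w k (foldr (prune_step w k) es S) e"
proof (induction es)
  case (Cons f es)
  let ?S = "foldr (prune_step w k) es S"
  show ?case
  proof (cases "redundant w k ?S f")
    case True
    then have eq: "foldr (prune_step w k) (f # es) S = filter (\<lambda>g. g \<noteq> f) ?S"
      by (simp add: prune_step_def)
    have "e \<in> set es" "e \<in> set ?S" using Cons.prems unfolding eq by auto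
    then show ?thesis using Cons.IH redundant_filter unfolding eq by blast
  next
    case False
    then have eq: "foldr (prune_step w k) (f # es) S = ?S"
      by (simp add: prune_step_def)
    show ?thesis
      using Cons.IH Cons.prems False unfolding eq by (cases "e = f") auto
  qed
qed simp

section \<open>Safety of deletions and the bound on the remaining edges\<close>

definition covers :: "(nat \<Rightarrow> nat \<Rightarrow> nat) \<Rightarrow> (nat \<Rightarrow> real) \<Rightarrow> nat \<times> nat \<Rightarrow> bool" where
  "covers w p = (\<lambda>(u, v). real (w u v) \<le> p u \<or> real (w v u) \<le> p v)"

text \<open>Since each edge is stored in one orientation only, different entries at a vertex have
  different other endpoints.\<close>

definition edges_on :: "nat set \<Rightarrow> (nat \<Rightarrow> nat \<Rightarrow> nat) \<Rightarrow> (nat \<times> nat) list \<Rightarrow> bool" where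
  "edges_on V w S \<longleftrightarrow> finite V \<and> distinct S \<and>
    (\<forall>(u, v)\<in>set S. u < v \<and> u \<in> V \<and> v \<in> V \<and> 0 < w u v \<and> 0 < w v u)"

text \<open>
  If \<open>p x < a\<close>, then every edge counted in the second assumption, except possibly \<open>e\<close>, is covered
  by its endpoint other than \<open>x\<close>, which gives more than \<open>k\<close> vertices with a positive value.
\<close>

lemma many_hits_force:
  assumes S: "edges_on V w S" and many: "Suc k < length (filter (hit w x a) S)"
    and p: "card {v \<in> V. 0 < p v} \<le> k" "\<And>f. f \<in> set S \<Longrightarrow> f \<noteq> e \<Longrightarrow> covers w p f"
  shows "real a \<le> p x"
proof (rule ccontr)
  assume "\<not> real a \<le> p x"
  then have less: "p x < real a" by simp
  define C where "C = {f \<in> set S. hit w x a f} - {e}"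
  have "card {f \<in> set S. hit w x a f} = length (filter (hit w x a) S)"
    using S unfolding edges_on_def by (metis distinct_card distinct_filter set_filter)
  \<comment> \<open>Removing \<open>e\<close> costs at most one hit, which is why the hypothesis
    demands more than \<open>Suc k\<close>.\<close>
  then have C: "k < card C"
    using many unfolding C_def by (auto simp: card_Diff_singleton_if)
  define other where "other = (\<lambda>(u, v). if u = x then v else u)"
  have inj: "inj_on other C"
  proof (rule inj_onI)
    fix f g assume fg: "f \<in> C" "g \<in> C" "other f = other g"
    obtain u v where f: "f = (u, v)" by (cases f)
    obtain c d where g: "g = (c, d)" by (cases g)
    have "u < v" "c < d" "x = u \<or> x = v" "x = c \<or> x = d"
      using fg S unfolding f g C_def edges_on_def hit_def by auto
    then show "f = g" using fg(3) unfolding f g other_def by (auto split: if_splits)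
  qed
  have "other ` C \<subseteq> {v \<in> V. 0 < p v}"
  proof
    fix y assume "y \<in> other ` C"
    then obtain u v where uv: "(u, v) \<in> C" "y = other (u, v)" by auto
    have *: "u < v" "u \<in> V" "v \<in> V" "0 < w u v" "0 < w v u" "hit w x a (u, v)" "covers w p (u, v)"
      using uv(1) S p(2)[of "(u, v)"] unfolding C_def edges_on_def by auto
    show "y \<in> {v \<in> V. 0 < p v}"
    proof (cases "u = x")
      case True
      then show ?thesis using * uv(2) less by (auto simp: other_def hit_def covers_def)
    next
      case False
      then show ?thesis using * uv(2) less by (auto simp: other_def hit_def covers_def)
    qed
  qed
  then have "card C \<le> card {v \<in> V. 0 < p v}"
    using inj S unfolding edges_on_def by (intro card_inj_on_le) auto
  then show False using C p(1) by simp
qed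

text \<open>The threshold in \<open>redundant\<close> is the weight of \<open>e\<close> at the
  crowded endpoint; the power forced there by the other edges therefore covers
  \<open>e\<close>.\<close>

lemma covers_redundant:
  assumes "edges_on V w S" "card {v \<in> V. 0 < p v} \<le> k" "redundant w k S e"
    "\<And>f. f \<in> set S \<Longrightarrow> f \<noteq> e \<Longrightarrow> covers w p f"
  shows "covers w p e"
  using assms(3) many_hits_force[OF assms(1) _ assms(2,4)]
  unfolding redundant_def covers_def by (cases e) auto

lemma edges_on_filter: "edges_on V w S \<Longrightarrow> edges_on V w (filter Q S)"
  by (auto simp: edges_on_def)

text \<open>Every deleted edge is implied by the edges present at its deletion, so induction over
  the steps chains the equivalences, with the same \<open>p\<close> throughout.\<close>

lemma covers_prune:
  assumes S: "edges_on V w S" and p: "card {v \<in> V. 0 < p v} \<le> k"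
  shows "(\<forall>e \<in> set (foldr (prune_step w k) es S). covers w p e) \<longleftrightarrow> (\<forall>e \<in> set S. covers w p e)"
proof (induction es)
  case (Cons e es)
  let ?S = "foldr (prune_step w k) es S"
  have "edges_on V w ?S"
    using prune_filter[of w k es S] edges_on_filter[OF S] by auto
  from covers_redundant[OF this p, of e]
  have "(\<forall>e \<in> set (prune_step w k e ?S). covers w p e) \<longleftrightarrow> (\<forall>e \<in> set ?S. covers w p e)"
    by (auto simp: prune_step_def)
  then show ?case using Cons by simp
qed simp

text \<open>If too many edges met at \<open>x\<close>, then one of least weight at \<open>x\<close> would be redundant.\<close>

lemma degree_irredundant:
  assumes S: "edges_on V w S" and irr: "\<And>e. e \<in> set S \<Longrightarrow> \<not> redundant w k S e"
  shows "length (filter (\<lambda>(u, v). x = u \<or> x = v) S) \<le> Suc k"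
proof (rule ccontr)
  let ?I = "filter (\<lambda>(u, v). x = u \<or> x = v) S"
  assume many: "\<not> length ?I \<le> Suc k"
  define wt where "wt = (\<lambda>(u, v). if x = u then w u v else w v u)"
  have "set ?I \<noteq> {}" using many by (metis le0 list.size(3) set_empty)
  then obtain e where e: "e \<in> set ?I" and least: "\<And>f. f \<in> set ?I \<Longrightarrow> wt e \<le> wt f"
    using ex_is_arg_min_if_finite[of "set ?I" wt] unfolding is_arg_min_linorder by blast
  \<comment> \<open>By minimality of \<open>wt e\<close>, every edge at \<open>x\<close> reaches
    this threshold, so the hits are exactly the incident edges.\<close>
  have "hit w x (wt e) f \<longleftrightarrow> (case f of (u, v) \<Rightarrow> x = u \<or> x = v)" if "f \<in> set S" for f
    using S least[of f] that by (cases f) (auto simp: hit_def wt_def edges_on_def split: if_splits)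
  then have "filter (hit w x (wt e)) S = ?I" by (intro filter_cong) auto
  then have "redundant w k S e"
    using many e S by (cases e) (auto simp: redundant_def wt_def edges_on_def split: if_splits)
  then show False using irr e by auto
qed

text \<open>Weights are positive, so every edge has an endpoint of positive power. At most
  \<open>k\<close> vertices are positive, and each meets at most \<open>Suc k\<close> edges.\<close>

lemma length_irredundant:
  assumes S: "edges_on V w S" and irr: "\<And>e. e \<in> set S \<Longrightarrow> \<not> redundant w k S e"
    and p: "card {v \<in> V. 0 < p v} \<le> k" "\<And>e. e \<in> set S \<Longrightarrow> covers w p e"
  shows "length S \<le> k * Suc k"
proof -
  let ?X = "{v \<in> V. 0 < p v}"
  let ?I = "\<lambda>x. set (filter (\<lambda>(u, v). x = u \<or> x = v) S)"
  have "set S \<subseteq> (\<Union>x\<in>?X. ?I x)"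
  proof
    fix e assume e: "e \<in> set S"
    obtain u v where uv: "e = (u, v)" by (cases e)
    have "u \<in> ?X \<or> v \<in> ?X"
      using S e p(2)[OF e] unfolding uv edges_on_def covers_def by force
    then show "e \<in> (\<Union>x\<in>?X. ?I x)" using e uv by auto
  qed
  moreover have fin: "finite ?X" using S by (simp add: edges_on_def)
  ultimately have "card (set S) \<le> card (\<Union>x\<in>?X. ?I x)" by (intro card_mono) auto
  also have "\<dots> \<le> (\<Sum>x\<in>?X. card (?I x))" by (rule card_UN_le[OF fin])
  also have "\<dots> \<le> (\<Sum>x\<in>?X. Suc k)"
    using degree_irredundant[OF S irr] by (intro sum_mono le_trans[OF card_length])
  also have "\<dots> \<le> k * Suc k" using mult_le_mono1[OF p(1), of "Suc k"] by simp
  finally show ?thesis using S by (simp add: distinct_card edges_on_def)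
qed

section \<open>Pruning on encoded lists\<close>

lemma enc_edge_sel [simp]:
  "left (left (enc_edge w e)) = enc_nat (fst e)"
  "right (left (enc_edge w e)) = enc_nat (snd e)"
  "left (right (enc_edge w e)) = enc_nat (w (fst e) (snd e))"
  "right (right (enc_edge w e)) = enc_nat (w (snd e) (fst e))"
  by (auto simp: enc_edge_def split: prod.splits)

lemma hitT_enc:
  assumes "fst e < snd e"
  shows "hitT (enc_nat x) (enc_nat a) (enc_edge w e) \<noteq> Leaf \<longleftrightarrow> hit w x a e"
  using assms by (cases e) (auto simp: hitT_def hit_def leqT_enc_nat)

text \<open>The extra \<open>right\<close> in \<open>busyT\<close> accounts for the successor.
  Capping \<open>k\<close> at \<open>m\<close> is harmless: if \<open>k\<close> exceeds
  \<open>m\<close>, no list of length at most \<open>m\<close> passes either test.\<close>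

lemma busyT_enc:
  assumes "\<And>e. e \<in> set S \<Longrightarrow> fst e < snd e" "lenT u = min k m" "length S \<le> m"
  shows "busyT u (enc_nat x) (enc_nat a) (enc_list (enc_edge w) S) \<noteq> Leaf \<longleftrightarrow>
    Suc k < length (filter (hit w x a) S)"
proof -
  have "filterT (hitT (enc_nat x) (enc_nat a)) (enc_list (enc_edge w) S) =
      enc_list (enc_edge w) (filter (hit w x a) S)"
    by (rule filterT_enc_list, rule hitT_enc, rule assms(1))
  moreover have "length (filter (hit w x a) S) \<le> m"
    using assms(3) length_filter_le le_trans by blast
  ultimately show ?thesis
    using assms(2) unfolding busyT_def lenT_eq_0[symmetric]
    by (auto simp: lenT_dropT lenT_right)
qed

lemma redundantT_enc:
  assumes "\<And>e. e \<in> set S \<Longrightarrow> fst e < snd e" "lenT u = min k m" "length S \<le> m"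
  shows "redundantT u (enc_edge w e) (enc_list (enc_edge w) S) \<noteq> Leaf \<longleftrightarrow> redundant w k S e"
  using busyT_enc[OF assms, where w = w]
  by (cases e) (auto simp: redundantT_def redundant_def)

lemma removeT_enc:
  "removeT (enc_edge w e) (enc_list (enc_edge w) S) = enc_list (enc_edge w) (filter (\<lambda>f. f \<noteq> e) S)"
  unfolding removeT_def by (rule filterT_enc_list) auto

lemma pruneT_enc:
  assumes "\<And>e. e \<in> set E \<Longrightarrow> fst e < snd e" "lenT u = min k (length E)"
  shows "pruneT u (enc_list (enc_edge w) E) = enc_list (enc_edge w) (foldr (prune_step w k) E E)"
proof -
  let ?F = "\<lambda>e S. if redundantT u e S \<noteq> Leaf then removeT e S else S"
  have "foldrT ?F (enc_list (enc_edge w) es) (enc_list (enc_edge w) E) =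
      enc_list (enc_edge w) (foldr (prune_step w k) es E)" for es
  proof (induction es)
    case (Cons e es)
    \<comment> \<open>As a filter of \<open>E\<close>, the current list is no longer than
      \<open>E\<close>, so the cap \<open>length E\<close> remains valid at every step.\<close>
    obtain Q where Q: "foldr (prune_step w k) es E = filter Q E" using prune_filter by blast
    have "redundantT u (enc_edge w e) (enc_list (enc_edge w) (filter Q E)) \<noteq> Leaf \<longleftrightarrow>
        redundant w k (filter Q E) e"
      using assms by (intro redundantT_enc) auto
    then show ?case
      unfolding enc_list.simps foldrT.simps Cons foldr.simps o_apply Q
      by (simp add: removeT_enc prune_step_def)
  qed simp
  then show ?thesis by (simp add: pruneT_def)
qed

section \<open>The kernel\<close>

definition edge_list :: "dpvc \<Rightarrow> (nat \<times> nat) list" where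
  "edge_list I = sorted_list_of_set {(u, v) \<in> parcs (ugraph I). u < v}"

definition kept :: "dpvc \<Rightarrow> (nat \<times> nat) list" where
  "kept I = foldr (prune_step (weight I) (param I)) (edge_list I) (edge_list I)"

definition touched :: "dpvc \<Rightarrow> nat \<Rightarrow> bool" where
  "touched I v \<longleftrightarrow> (\<exists>(c, d) \<in> set (kept I). v = c \<or> v = d)"

text \<open>The first branch is a no-instance, since the empty sum exceeds the budget. In the
  second, the converse restores the opposite orientations of the kept edges.\<close>

definition kernel :: "dpvc \<Rightarrow> dpvc" where
  "kernel I =
    (if param I * Suc (param I) < length (kept I)
     then I\<lparr>ugraph := \<lparr>pverts = {}, parcs = {}\<rparr>, budget := -1\<rparr>
     else I\<lparr>ugraph := \<lparr>pverts = {v \<in> pverts (ugraph I). touched I v},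
                     parcs = set (kept I) \<union> (set (kept I))\<inverse>\<rparr>\<rparr>)"

lemma pair_graph_iff:
  "pair_graph G \<longleftrightarrow> finite (pverts G) \<and> finite (parcs G) \<and>
    (\<forall>(u, v) \<in> parcs G. u \<in> pverts G \<and> v \<in> pverts G \<and> u \<noteq> v \<and> (v, u) \<in> parcs G)"
  (is "?L \<longleftrightarrow> ?R")
proof
  assume ?L
  then interpret pair_graph G .
  have "(v, u) \<in> parcs G" if "(u, v) \<in> parcs G" for u v
    using pair_sym_arcs that unfolding symmetric_def with_proj_simps by (meson symD)
  then show ?R
    using pair_finite_verts pair_finite_arcs in_arcsD1 in_arcsD2 pair_no_loops by auto blast
next
  assume R: ?R
  then have "symmetric G"
    unfolding symmetric_def with_proj_simps by (auto intro!: symI)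
  then show ?L
    using R by unfold_locales auto
qed

context
  fixes I
  assumes I: "I \<in> dpvc_instances"
begin

lemma set_edge_list: "set (edge_list I) = {(u, v) \<in> parcs (ugraph I). u < v}"
proof -
  have "finite {(u, v) \<in> parcs (ugraph I). u < v}"
    using I by (auto simp: dpvc_instances_def pair_graph_iff intro: rev_finite_subset)
  then show ?thesis by (simp add: edge_list_def)
qed

lemma kept_filter: "\<exists>Q. kept I = filter Q (edge_list I)"
  unfolding kept_def by (rule prune_filter)

lemma set_kept: "(u, v) \<in> set (kept I) \<Longrightarrow> (u, v) \<in> parcs (ugraph I) \<and> u < v"
  using kept_filter set_edge_list by auto

lemma edges_on_edge_list: "edges_on (pverts (ugraph I)) (weight I) (edge_list I)"
proof -
  have "distinct (edge_list I)" by (simp add: edge_list_def)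
  moreover have "u < v \<and> u \<in> pverts (ugraph I) \<and> v \<in> pverts (ugraph I) \<and> 0 < weight I u v \<and> 0 < weight I v u"
    if "(u, v) \<in> set (edge_list I)" for u v
  proof -
    have *: "(u, v) \<in> parcs (ugraph I)" "u < v" using that by (auto simp: set_edge_list)
    then have "(v, u) \<in> parcs (ugraph I)" "u \<in> pverts (ugraph I)" "v \<in> pverts (ugraph I)"
      using I by (auto simp: dpvc_instances_def pair_graph_iff)
    then show ?thesis using * I by (auto simp: dpvc_instances_def)
  qed
  moreover have "finite (pverts (ugraph I))"
    using I by (simp add: dpvc_instances_def pair_graph_iff)
  ultimately show ?thesis unfolding edges_on_def by blast
qed

lemma edges_on_kept: "edges_on (pverts (ugraph I)) (weight I) (kept I)"
  using kept_filter edges_on_filter[OF edges_on_edge_list] by auto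

lemma kept_irredundant: "e \<in> set (kept I) \<Longrightarrow> \<not> redundant (weight I) (param I) (kept I) e"
  unfolding kept_def
  by (rule prune_irredundant) (use prune_filter[of "weight I" "param I" "edge_list I" "edge_list I"] in auto)

lemma touched_pverts: "touched I v \<Longrightarrow> v \<in> pverts (ugraph I)"
  using edges_on_kept by (auto simp: touched_def edges_on_def)

lemma pverts_kernel:
  "\<not> param I * Suc (param I) < length (kept I) \<Longrightarrow> pverts (ugraph (kernel I)) = {v. touched I v}"
  using touched_pverts by (auto simp: kernel_def)

lemma kernel_instance: "kernel I \<in> dpvc_instances"
proof (cases "param I * Suc (param I) < length (kept I)")
  case True
  then show ?thesis by (simp add: kernel_def dpvc_instances_def pair_graph_iff)
next
  case False
  let ?J = "kernel I"
  have "finite (pverts (ugraph I))"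
    using I by (simp add: dpvc_instances_def pair_graph_iff)
  then have "finite (pverts (ugraph ?J))" "finite (parcs (ugraph ?J))"
    using False by (auto simp: kernel_def)
  moreover have "u \<in> pverts (ugraph ?J) \<and> v \<in> pverts (ugraph ?J) \<and> u \<noteq> v \<and>
      (v, u) \<in> parcs (ugraph ?J) \<and> 0 < weight ?J u v" if uv: "(u, v) \<in> parcs (ugraph ?J)" for u v
  proof -
    have kept: "(u, v) \<in> set (kept I) \<or> (v, u) \<in> set (kept I)"
      using uv False by (auto simp: kernel_def)
    then have "touched I u" "touched I v" "(v, u) \<in> parcs (ugraph ?J)"
      using False by (auto simp: touched_def kernel_def)
    moreover have "u \<noteq> v" "0 < weight I u v"
      using kept edges_on_kept by (auto simp: edges_on_def)
    moreover have "weight ?J = weight I" using False by (simp add: kernel_def)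
    ultimately show ?thesis by (simp add: pverts_kernel[OF False])
  qed
  ultimately show ?thesis
    unfolding dpvc_instances_def pair_graph_iff by auto
qed

text \<open>In the main case, every vertex left is an endpoint of a kept edge, and every edge has
  two endpoints.\<close>

lemma card_kernel: "card (pverts (ugraph (kernel I))) \<le> 2 * (param I * Suc (param I))"
proof (cases "param I * Suc (param I) < length (kept I)")
  case True
  then show ?thesis by (simp add: kernel_def)
next
  case False
  have "{v. touched I v} = fst ` set (kept I) \<union> snd ` set (kept I)"
    by (force simp: touched_def)
  then have "card {v. touched I v} \<le> card (fst ` set (kept I)) + card (snd ` set (kept I))"
    by (simp add: card_Un_le)
  also have "\<dots> \<le> length (kept I) + length (kept I)"
    by (intro add_mono le_trans[OF card_image_le card_length]) auto
  finally show ?thesis using False by (simp add: pverts_kernel)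
qed

section \<open>Equivalence of the instance and its kernel\<close>

text \<open>The covering condition is symmetric under swapping the endpoints, so one orientation per
  edge suffices.\<close>

lemma feasible_edge_list:
  "feasible I p \<longleftrightarrow>
    (\<forall>v \<in> pverts (ugraph I). 0 \<le> p v) \<and> (\<forall>e \<in> set (edge_list I). covers (weight I) p e)"
proof -
  have "(\<forall>(u, v) \<in> parcs (ugraph I). covers (weight I) p (u, v)) \<longleftrightarrow>
      (\<forall>(u, v) \<in> set (edge_list I). covers (weight I) p (u, v))"
  proof (intro iffI ballI; clarify)
    fix u v assume *: "\<forall>(u, v) \<in> set (edge_list I). covers (weight I) p (u, v)"
      "(u, v) \<in> parcs (ugraph I)"
    then have "(v, u) \<in> parcs (ugraph I)" "u \<noteq> v"
      using I by (auto simp: dpvc_instances_def pair_graph_iff)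
    then have "(u, v) \<in> set (edge_list I) \<or> (v, u) \<in> set (edge_list I)"
      using *(2) by (auto simp: set_edge_list)
    then show "covers (weight I) p (u, v)"
      using *(1) by (auto simp: covers_def)
  qed (auto simp: set_edge_list)
  then show ?thesis by (auto simp: feasible_def covers_def)
qed

lemma feasible_kernel:
  assumes "\<not> param I * Suc (param I) < length (kept I)"
  shows "feasible (kernel I) p \<longleftrightarrow>
    (\<forall>v. touched I v \<longrightarrow> 0 \<le> p v) \<and> (\<forall>e \<in> set (kept I). covers (weight I) p e)"
  unfolding feasible_def pverts_kernel[OF assms] using assms
  by (auto simp: kernel_def covers_def)

lemma covers_kept:
  assumes "card {v \<in> pverts (ugraph I). 0 < p v} \<le> param I"
  shows "(\<forall>e \<in> set (kept I). covers (weight I) p e) \<longleftrightarrow> (\<forall>e \<in> set (edge_list I). covers (weight I) p e)"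
  unfolding kept_def by (rule covers_prune[OF edges_on_edge_list assms])

text \<open>Too many kept edges contradict \<open>length_irredundant\<close>. Otherwise a solution
  is restricted to the touched vertices or extended by zero from them, and
  \<open>covers_kept\<close> handles the deleted edges.\<close>

lemma yes_kernel: "dpvc_yes (kernel I) \<longleftrightarrow> dpvc_yes I"
proof (cases "param I * Suc (param I) < length (kept I)")
  case True
  have "\<not> dpvc_yes I"
  proof
    assume "dpvc_yes I"
    then obtain p where p: "feasible I p" "card {v \<in> pverts (ugraph I). 0 < p v} \<le> param I"
      unfolding dpvc_yes_def by blast
    then have "length (kept I) \<le> param I * Suc (param I)"
      using length_irredundant[OF edges_on_kept kept_irredundant p(2)] covers_kept[OF p(2)]
      by (simp add: feasible_edge_list)
    then show False using True by simp
  qed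
  then show ?thesis using True by (simp add: dpvc_yes_def kernel_def)
next
  case False
  note V = pverts_kernel[OF False]
  have other: "param (kernel I) = param I" "budget (kernel I) = budget I"
    using False by (auto simp: kernel_def)
  have fin: "finite (pverts (ugraph I))"
    using I by (auto simp: dpvc_instances_def pair_graph_iff)
  have sub: "{v. touched I v} \<subseteq> pverts (ugraph I)"
    using touched_pverts by blast
  show ?thesis
  proof
    assume "dpvc_yes I"
    then obtain p where p: "feasible I p" "(\<Sum>v \<in> pverts (ugraph I). p v) \<le> real_of_int (budget I)"
      "card {v \<in> pverts (ugraph I). 0 < p v} \<le> param I"
      unfolding dpvc_yes_def by blast
    have "feasible (kernel I) p"
      using p(1) covers_kept[OF p(3)] sub unfolding feasible_kernel[OF False] feasible_edge_list by auto
    moreover have "(\<Sum>v \<in> {v. touched I v}. p v) \<le> (\<Sum>v \<in> pverts (ugraph I). p v)"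
      using p(1) fin sub by (intro sum_mono2) (auto simp: feasible_def)
    moreover have "card {v \<in> {v. touched I v}. 0 < p v} \<le> card {v \<in> pverts (ugraph I). 0 < p v}"
      using fin sub by (intro card_mono) auto
    ultimately show "dpvc_yes (kernel I)"
      using p(2,3) unfolding dpvc_yes_def V other by (intro exI[of _ p]) auto
  next
    assume "dpvc_yes (kernel I)"
    then obtain p where p: "feasible (kernel I) p"
      "(\<Sum>v \<in> {v. touched I v}. p v) \<le> real_of_int (budget I)"
      "card {v \<in> {v. touched I v}. 0 < p v} \<le> param I"
      unfolding dpvc_yes_def V other by blast
    \<comment> \<open>Outside the kernel \<open>p\<close> is arbitrary, possibly negative. Setting
      it to 0 preserves the total power and the number of positive vertices.\<close>
    define p' where "p' v = (if touched I v then p v else 0)" for v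
    have "{v \<in> pverts (ugraph I). 0 < p' v} = {v \<in> {v. touched I v}. 0 < p v}"
      using sub by (auto simp: p'_def)
    then have card: "card {v \<in> pverts (ugraph I). 0 < p' v} \<le> param I"
      using p(3) by simp
    have "covers (weight I) p' e" if "e \<in> set (kept I)" for e
    proof -
      have "touched I (fst e)" "touched I (snd e)" using that by (cases e; force simp: touched_def)+
      then show ?thesis
        using p(1) that unfolding feasible_kernel[OF False] by (cases e) (auto simp: covers_def p'_def)
    qed
    then have "\<forall>e \<in> set (edge_list I). covers (weight I) p' e"
      using covers_kept[OF card] by blast
    moreover have "0 \<le> p' v" for v
      using p(1) unfolding feasible_kernel[OF False] by (simp add: p'_def)
    ultimately have "feasible I p'"
      unfolding feasible_edge_list by blast
    moreover have "(\<Sum>v \<in> pverts (ugraph I). p' v) = (\<Sum>v \<in> {v. touched I v}. p v)"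
      using fin sub by (intro sum.mono_neutral_cong_right) (auto simp: p'_def)
    ultimately show "dpvc_yes I"
      using p(2) card unfolding dpvc_yes_def by (intro exI[of _ p']) auto
  qed
qed

section \<open>Agreement of the tree function with the kernel\<close>

text \<open>The trees must be equal, not merely encode the same sets. Filtering keeps the vertex and
  edge lists sorted and distinct, so they are the canonical lists of the kernel.\<close>

lemma kernelT_enc: "kernelT (enc_dpvc I) = enc_dpvc (kernel I)"
proof -
  let ?w = "weight I" and ?k = "param I" and ?V = "sorted_list_of_set (pverts (ugraph I))"
  define u where "u = capT (enc_nat ?k) (enc_list (enc_edge ?w) (edge_list I))"
  have u: "lenT u = min ?k (length (edge_list I))"
    by (simp add: u_def lenT_capT)
  have prune: "pruneT u (enc_list (enc_edge ?w) (edge_list I)) = enc_list (enc_edge ?w) (kept I)"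
    unfolding kept_def by (rule pruneT_enc[OF _ u]) (auto simp: set_edge_list)
  have le: "length (kept I) \<le> length (edge_list I)"
    using kept_filter by auto
  have "manyT u (enc_list (enc_edge ?w) (kept I)) \<noteq> Leaf \<longleftrightarrow>
      lenT u * Suc (lenT u) < length (kept I)"
    unfolding lenT_eq_0[symmetric] by (auto simp: lenT_manyT)
  also have "\<dots> \<longleftrightarrow> ?k * Suc ?k < length (kept I)"
  proof (cases "?k \<le> length (edge_list I)")
    case False
    \<comment> \<open>If \<open>k\<close> exceeds the number of edges, \<open>u\<close> is as long
      as the edge list, and both comparisons fail.\<close>
    then have "length (kept I) \<le> lenT u" "length (kept I) \<le> ?k" using u le by auto
    then have "length (kept I) \<le> lenT u * Suc (lenT u)" "length (kept I) \<le> ?k * Suc ?k"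
      by (auto intro: trans_le_add1)
    then show ?thesis by simp
  qed (simp add: u)
  finally have many: "manyT u (enc_list (enc_edge ?w) (kept I)) \<noteq> Leaf \<longleftrightarrow>
    ?k * Suc ?k < length (kept I)" .
  have "touchT (enc_list (enc_edge ?w) (kept I)) (enc_nat v) =
      enc_list (enc_edge ?w) (filter (\<lambda>(c, d). v = c \<or> v = d) (kept I))" for v
    unfolding touchT_def by (rule filterT_enc_list) auto
  then have "touchT (enc_list (enc_edge ?w) (kept I)) (enc_nat v) \<noteq> Leaf \<longleftrightarrow> touched I v" for v
    unfolding lenT_eq_0[symmetric] by (auto simp: touched_def filter_empty_conv)
  then have V: "filterT (touchT (enc_list (enc_edge ?w) (kept I))) (enc_list enc_nat ?V) =
      enc_list enc_nat (filter (touched I) ?V)"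
    by (intro filterT_enc_list)
  have x: "kernelT (enc_dpvc I) = finishT (enc_list enc_nat ?V) u
      (enc_list (enc_edge ?w) (kept I)) (enc_nat ?k) (enc_int (budget I))"
    by (simp add: kernelT_def enc_dpvc_def edge_list_def[symmetric] u_def[symmetric] prune)
  show ?thesis
  proof (cases "?k * Suc ?k < length (kept I)")
    case True
    \<comment> \<open>The literal tree in \<open>finishT\<close> is the encoding of the empty graph,
      the old parameter and \<open>enc_int (-1)\<close>.\<close>
    then show ?thesis
      using many unfolding x finishT_def
      by (simp add: kernel_def enc_dpvc_def enc_int_def enc_bool_def enc_nat_pos)
  next
    case False
    have "sorted (filter (touched I) ?V)" "distinct (filter (touched I) ?V)"
      by (auto simp: sorted_filter[of "\<lambda>x. x", simplified])
    moreover have "set (filter (touched I) ?V) = pverts (ugraph (kernel I))"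
      using I False by (auto simp: kernel_def dpvc_instances_def pair_graph_iff)
    ultimately have 1: "sorted_list_of_set (pverts (ugraph (kernel I))) = filter (touched I) ?V"
      using sorted_list_of_set.idem_if_sorted_distinct by metis
    have "sorted (kept I)" "distinct (kept I)"
      using kept_filter by (auto simp: edge_list_def sorted_filter[of "\<lambda>x. x", simplified])
    moreover have "set (kept I) = {(u, v) \<in> parcs (ugraph (kernel I)). u < v}"
      using False set_kept by (fastforce simp: kernel_def)
    ultimately have 2: "sorted_list_of_set {(u, v) \<in> parcs (ugraph (kernel I)). u < v} = kept I"
      using sorted_list_of_set.idem_if_sorted_distinct by metis
    have "weight (kernel I) = ?w" "param (kernel I) = ?k" "budget (kernel I) = budget I"
      using False by (auto simp: kernel_def)
    then show ?thesis
      using many False unfolding x finishT_def enc_dpvc_def[of "kernel I"] 1 2 V by simp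
  qed
qed

end

theorem theorem10:
  shows "\<exists>(K :: dpvc \<Rightarrow> dpvc) (g :: nat \<Rightarrow> real).
    kernelization enc_dpvc dpvc_instances dpvc_yes param K \<and>
    g \<in> O(\<lambda>k. real k ^ 2) \<and>
    (\<forall>I \<in> dpvc_instances. real (card (pverts (ugraph (K I)))) \<le> g (param I))"
proof (intro exI conjI ballI)
  have "param (kernel I) = param I" for I by (simp add: kernel_def)
  then show "kernelization enc_dpvc dpvc_instances dpvc_yes param kernel"
    unfolding kernelization_def
    using ptime_poly_time_on[OF ptime_kernelT, of dpvc_instances enc_dpvc kernel]
      kernelT_enc kernel_instance yes_kernel by auto
  show "(\<lambda>k. real (2 * (k * Suc k))) \<in> O(\<lambda>k. real k ^ 2)"
  \<comment> \<open>The constant 4 comes from \<open>Suc k \<le> 2 * k\<close>, valid from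
    \<open>k = 1\<close> on.\<close>
  proof (rule bigoI[of _ 4])
    have "real (2 * (k * Suc k)) \<le> 4 * real k ^ 2" if "k \<ge> 1" for k
    proof -
      have "2 * (k * Suc k) \<le> 4 * k ^ 2" using that by (simp add: power2_eq_square)
      then show ?thesis by (metis of_nat_le_iff of_nat_mult of_nat_numeral of_nat_power)
    qed
    then show "\<forall>\<^sub>F k in at_top. norm (real (2 * (k * Suc k))) \<le> 4 * norm (real k ^ 2)"
      unfolding eventually_at_top_linorder by (intro exI[of _ 1]) auto
  qed
  show "real (card (pverts (ugraph (kernel I)))) \<le> real (2 * (param I * Suc (param I)))"
    if "I \<in> dpvc_instances" for I
    using card_kernel[OF that] of_nat_le_iff by blast
qed

end
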